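(* For every positive integer $n$ and every diagram $D\subseteq[n]\times[n]$, the dual character $\chi_D(x_1,\ldots,x_n)$ of the flagged Weyl module $\mathcal{M}_D$ satisfies \[\chi_D(1,\ldots,1)\ \geq\ \mathrm{rank}(D)+1.\]
   Context: Let $[n]=\{1,\ldots,n\}$. A diagram is a sequence $D=(D_1,\ldots,D_n)$ of subsets of $[n]$, called the columns of $D$. It is identified with the set of boxes $(i,j)\in[n]\times[n]$ with $i\in D_j$ (box in row $i$, column $j$; rows are numbered top to bottom). For $R,S\subseteq[n]$, write $R\leq S$ if $\#R=\#S$ and, for each $k$, the $k$th least element of $R$ does not exceed the $k$th least element of $S$. For diagrams $C=(C_1,\ldots,C_n)$ and $D=(D_1,\ldots,D_n)$, write $C\leq D$ if $C_j\leq D_j$ for all $j\in[n]$. Let $Y$ be the $n\times n$ matrix with indeterminates $y_{ij}$ in positions $i\leq j$ and zeros elsewhere, and let $\mathbb{C}[Y]$ be the polynomial ring in $\{y_{ij}\}_{i\leq j}$. For $R,S\subseteq[n]$ let $Y_S^R$ be the submatrix of $Y$ with rows $R$ and columns $S$ (the determinant of the empty matrix is $1$). Let $B$ be the group of invertible upper-triangular $n\times n$ complex matrices, acting on $\mathbb{C}[Y]$ by $f(Y)\cdot b=f(b^{-1}Y)$. The flagged Weyl module of $D$ is the $B$-module \[\mathcal{M}_D=\mathrm{Span}_{\mathbb{C}}\Big\{\prod_{j=1}^n\det\big(Y_{D_j}^{C_j}\big)\ :\ C\leq D\Big\}\subseteq\mathbb{C}[Y].\] For a $B$-module $N$, its character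 is $\mathrm{char}(N)(x_1,\ldots,x_n)=\mathrm{tr}(X:N\to N)$, where $X$ is the diagonal matrix with diagonal entries $x_1,\ldots,x_n$ acting through the $B$-action. Its dual character is the character of the dual module $N^*$, i.e. $\mathrm{char}^*(N)(x_1,\ldots,x_n)=\mathrm{char}(N)(x_1^{-1},\ldots,x_n^{-1})$. Define $\chi_D=\mathrm{char}^*(\mathcal{M}_D)$, a polynomial in $x_1,\ldots,x_n$. For a box $(i,j)\in D$, let $\mathrm{rank}_D(i,j)=\#\{k: 1\leq k\leq i\text{ and }(k,j)\notin D\}$. The rank of $D$ is $\mathrm{rank}(D)=\sum_{(i,j)\in D}\mathrm{rank}_D(i,j)$. *)

theory Defs
  imports
    "HOL-Library.Poly_Mapping"
    "HOL-Library.Complex_Order"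
    "Jordan_Normal_Form.Determinant"
    "Jordan_Normal_Form.Gauss_Jordan_Elimination"
    "Jordan_Normal_Form.DL_Submatrix"
begin

text \<open>
  To match the matrix library, indices start at 0: the set $[n]$ is \<open>{..<n}\<close> throughout,
  so row and column \<open>i\<close> here are row and column \<open>i + 1\<close> in the 1-based convention.
\<close>

subsection \<open>Diagrams\<close>

text \<open>A diagram is given by its set of boxes \<open>(i, j)\<close> (row \<open>i\<close>, column \<open>j\<close>).\<close>

type_synonym diagram = "(nat \<times> nat) set"

definition is_diagram :: "nat \<Rightarrow> diagram \<Rightarrow> bool" where
  "is_diagram n D \<longleftrightarrow> D \<subseteq> {..<n} \<times> {..<n}"

definition column :: "diagram \<Rightarrow> nat \<Rightarrow> nat set" where
  "column D j = {i. (i, j) \<in> D}"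

text \<open>\<open>pick R k\<close> is the element of \<open>R\<close> with exactly \<open>k\<close> smaller elements in \<open>R\<close>
  (for \<open>k < card R\<close>).\<close>

definition set_leq :: "nat set \<Rightarrow> nat set \<Rightarrow> bool" where
  "set_leq R S \<longleftrightarrow> card R = card S \<and> (\<forall>k < card R. pick R k \<le> pick S k)"

definition diagram_leq :: "nat \<Rightarrow> diagram \<Rightarrow> diagram \<Rightarrow> bool" where
  "diagram_leq n C D \<longleftrightarrow> (\<forall>j < n. set_leq (column C j) (column D j))"

definition box_rank :: "diagram \<Rightarrow> nat \<times> nat \<Rightarrow> nat" where
  "box_rank D = (\<lambda>(i, j). card {k. k \<le> i \<and> (k, j) \<notin> D})"

definition diagram_rank :: "diagram \<Rightarrow> nat" where
  "diagram_rank D = (\<Sum>b\<in>D. box_rank D b)"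

subsection \<open>Polynomials in the indeterminates $y_{ij}$\<close>

text \<open>
  The type has an indeterminate for every pair of naturals; $\mathbb{C}[Y]$ is the subring of
  polynomials that only involve the entries of \<open>Y_mat n\<close>.
\<close>

type_synonym ypoly = "((nat \<times> nat) \<Rightarrow>\<^sub>0 nat) \<Rightarrow>\<^sub>0 complex"

definition yconst :: "complex \<Rightarrow> ypoly" where
  "yconst c = Poly_Mapping.single 0 c"

definition yvar :: "nat \<times> nat \<Rightarrow> ypoly" where
  "yvar v = Poly_Mapping.single (Poly_Mapping.single v 1) 1"

definition yscale :: "complex \<Rightarrow> ypoly \<Rightarrow> ypoly" where
  "yscale c f = yconst c * f"

global_interpretation ypoly: vector_space yscale
  by unfold_locales
    (simp_all add: yscale_def yconst_def algebra_simps single_add mult_single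
      flip: mult.assoc)

definition ysubst :: "(nat \<times> nat \<Rightarrow> ypoly) \<Rightarrow> ypoly \<Rightarrow> ypoly" where
  "ysubst \<sigma> f = (\<Sum>m\<in>Poly_Mapping.keys f. yconst (Poly_Mapping.lookup f m) *
      (\<Prod>v\<in>Poly_Mapping.keys m. \<sigma> v ^ Poly_Mapping.lookup m v))"

definition Y_mat :: "nat \<Rightarrow> ypoly mat" where
  "Y_mat n = mat n n (\<lambda>(i, j). if i \<le> j then yvar (i, j) else 0)"

subsection \<open>The action of the Borel group, and characters\<close>

text \<open>
  $f(Y) \cdot b = f(b^{-1} Y)$, for $b$ an invertible upper-triangular $n \times n$ matrix and
  \<open>f\<close> in $\mathbb{C}[Y]$; the values of \<open>borel_act\<close> at other arguments carry no meaning.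
\<close>

definition borel_act :: "nat \<Rightarrow> complex mat \<Rightarrow> ypoly \<Rightarrow> ypoly" where
  "borel_act n b f =
     ysubst (\<lambda>v. (map_mat yconst (the (mat_inverse b)) * Y_mat n) $$ v) f"

text \<open>
  The trace of a linear endomorphism \<open>T\<close> of a finite-dimensional subspace \<open>N\<close>, computed in an
  arbitrary basis of \<open>N\<close> (the result does not depend on the basis).
\<close>

definition trace_on :: "ypoly set \<Rightarrow> (ypoly \<Rightarrow> ypoly) \<Rightarrow> complex" where
  "trace_on N T =
     (let B = (SOME B. ypoly.independent B \<and> ypoly.span B = N)
      in \<Sum>b\<in>B. ypoly.representation B (T b) b)"

text \<open>Characters are functions on the torus: all \<open>x i\<close> with \<open>i < n\<close> are meant to be nonzero.\<close>

definition mod_char :: "nat \<Rightarrow> ypoly set \<Rightarrow> (nat \<Rightarrow> complex) \<Rightarrow> complex" where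
  "mod_char n N x = trace_on N (borel_act n (mat_diag n x))"

definition dual_char :: "nat \<Rightarrow> ypoly set \<Rightarrow> (nat \<Rightarrow> complex) \<Rightarrow> complex" where
  "dual_char n N x = mod_char n N (\<lambda>i. inverse (x i))"

subsection \<open>The flagged Weyl module\<close>

text \<open>\<open>submatrix A R S\<close> has row set \<open>R\<close> and column set \<open>S\<close>; the empty determinant is 1.\<close>

definition flagged_Weyl_module :: "nat \<Rightarrow> diagram \<Rightarrow> ypoly set" where
  "flagged_Weyl_module n D = ypoly.span
     {\<Prod>j<n. det (submatrix (Y_mat n) (column C j) (column D j)) | C.
        is_diagram n C \<and> diagram_leq n C D}"

definition Weyl_dual_char :: "nat \<Rightarrow> diagram \<Rightarrow> (nat \<Rightarrow> complex) \<Rightarrow> complex" where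
  "Weyl_dual_char n D = dual_char n (flagged_Weyl_module n D)"

end

theory Submission
  imports Defs "HOL-Library.Product_Lexorder"
begin

text \<open>
  At \<open>x = (1, \<dots>, 1)\<close> the torus element is the identity matrix, which acts trivially, so the
  dual character takes the value $\dim \mathcal{M}_D$
  (\<open>Weyl_dual_char_one\<close>). It remains to find \<open>rank(D) + 1\<close> linearly independent elements of
  the module.

  Grade $\mathbb{C}[Y]$ by giving $y_{ij}$ the degree \<open>i\<close>. Every term of a minor with row set
  \<open>R\<close> contains exactly one entry from each row in \<open>R\<close>, so the minor is homogeneous of degree
  \<open>\<Sum>R\<close>. Hence the generator attached to \<open>C \<le> D\<close> is homogeneous, and its degree is the sum of the
  row indices of all boxes of \<open>C\<close>. It is also nonzero: a minor with \<open>R \<le> S\<close> contains its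
  diagonal monomial with coefficient 1 (\<open>Y_minor_nonzero\<close>), and $\mathbb{C}[Y]$ is an integral
  domain. Nonzero elements of distinct degrees are linearly independent, so it suffices that
  \<open>rank(D) + 1\<close> degrees occur.

  Moving one box up by one row into an empty position keeps a diagram below \<open>D\<close> and lowers the
  degree by exactly 1. Such moves are possible until every column is justified to the top. Each
  move removes one pair consisting of a box and an empty position above it in the same column,
  and \<open>rank(D)\<close> counts these pairs, so the number of moves is \<open>rank(D)\<close>. Thus all
  degrees from that of \<open>D\<close> down to \<open>rank(D)\<close> less occur (\<open>diagram_leq_row_sum_exists\<close>).
\<close>

section \<open>Rows of a column\<close>

text \<open>
  Passing through \<open>pick\<close> turns sums over \<open>S\<close> into sums over positions \<open>k < card S\<close>, the form in
  which the row indices appear in a minor.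
\<close>

lemma bij_betw_pick:
  assumes "finite S"
  shows "bij_betw (pick S) {..<card S} S"
proof (rule bij_betw_byWitness[where f' = "\<lambda>x. card {a \<in> S. a < x}"])
  show "\<forall>k\<in>{..<card S}. card {a \<in> S. a < pick S k} = k"
    by (auto intro: card_pick)
  show "\<forall>x\<in>S. pick S (card {a \<in> S. a < x}) = x"
    by (auto intro: pick_card_in_set)
  show "pick S ` {..<card S} \<subseteq> S"
    by (auto intro: pick_in_set_le)
  show "(\<lambda>x. card {a \<in> S. a < x}) ` S \<subseteq> {..<card S}"
    using assms by (auto intro!: psubset_card_mono)
qed

lemma sum_pick:
  assumes "finite S"
  shows "(\<Sum>k<card S. g (pick S k)) = (\<Sum>x\<in>S. g x)"
  using sum.reindex_bij_betw[OF bij_betw_pick[OF assms]] .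

lemma pick_strict_mono_image:
  assumes "strict_mono_on S f" and "k < card S"
  shows "pick (f ` S) k = f (pick S k)"
proof -
  have mem: "pick S k \<in> S"
    using assms(2) by (rule pick_in_set_le)
  have less: "f a < f b \<longleftrightarrow> a < b" if "a \<in> S" "b \<in> S" for a b
    using assms(1) that by (rule strict_mono_on_less)
  have "{a \<in> f ` S. a < f (pick S k)} = f ` {a \<in> S. a < pick S k}"
    using less mem by auto
  moreover have "inj_on f {a \<in> S. a < pick S k}"
    using strict_mono_on_imp_inj_on[OF assms(1)] by (rule inj_on_subset) auto
  ultimately have "card {a \<in> f ` S. a < f (pick S k)} = k"
    using card_pick_le[OF assms(2)] by (simp add: card_image)
  then show ?thesis
    using pick_card_in_set[of "f (pick S k)" "f ` S"] mem by auto
qed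

lemma set_leq_refl: "set_leq S S"
  by (simp add: set_leq_def)

lemma set_leq_trans: "set_leq R S \<Longrightarrow> set_leq S T \<Longrightarrow> set_leq R T"
  by (force simp: set_leq_def)

lemma set_leq_image:
  assumes "strict_mono_on S f" and "\<And>x. x \<in> S \<Longrightarrow> f x \<le> x"
  shows "set_leq (f ` S) S"
  using assms strict_mono_on_imp_inj_on[OF assms(1)]
  by (auto simp: set_leq_def card_image pick_strict_mono_image pick_in_set_le)

lemma set_leq_bounded:
  assumes "set_leq R S" and "finite R" and "S \<subseteq> {..<n}"
  shows "R \<subseteq> {..<n}"
proof
  fix x assume "x \<in> R"
  then obtain k where k: "k < card R" "x = pick R k"
    using bij_betw_pick[OF assms(2)] by (auto simp: bij_betw_def)
  then have "x \<le> pick S k" "pick S k \<in> S"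
    using assms(1) by (auto simp: set_leq_def intro: pick_in_set_le)
  then show "x \<in> {..<n}"
    using assms(3) by auto
qed

text \<open>The contribution of a column with row set \<open>S\<close> to the rank of a diagram.\<close>

definition column_rank :: "nat set \<Rightarrow> nat" where
  "column_rank S = (\<Sum>i\<in>S. card {k. k \<le> i \<and> k \<notin> S})"

text \<open>
  Below \<open>i \<in> S\<close> there are \<open>i\<close> numbers. Those outside \<open>S\<close> are counted by the rank; those inside
  \<open>S\<close> are 0, 1, 2, \<open>\<dots>\<close> in number as \<open>i\<close> runs through \<open>S\<close>. So the rank is the amount by which
  \<open>\<Sum>S\<close> exceeds the least possible sum of a set of the same size.
\<close>

lemma sum_eq_column_rank:
  assumes "finite S"
  shows "\<Sum>S = column_rank S + \<Sum>{..<card S}"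
proof -
  have "i = card {k. k \<le> i \<and> k \<notin> S} + card {k \<in> S. k < i}" if "i \<in> S" for i
  proof -
    have "{..<i} = {k. k \<le> i \<and> k \<notin> S} \<union> {k \<in> S. k < i}"
      using that by (auto simp: le_less)
    then have "card {..<i} = card ({k. k \<le> i \<and> k \<notin> S} \<union> {k \<in> S. k < i})"
      by simp
    also have "\<dots> = card {k. k \<le> i \<and> k \<notin> S} + card {k \<in> S. k < i}"
      by (rule card_Un_disjoint) (auto intro: finite_subset[of _ "{..i}"])
    finally show ?thesis
      by simp
  qed
  then have "\<Sum>S = column_rank S + (\<Sum>i\<in>S. card {k \<in> S. k < i})"
    unfolding column_rank_def by (subst sum.distrib[symmetric]) (rule sum.cong, auto)
  also have "(\<Sum>i\<in>S. card {k \<in> S. k < i}) = (\<Sum>k<card S. card {a \<in> S. a < pick S k})"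
    using sum_pick[OF assms, of "\<lambda>i. card {k \<in> S. k < i}"] by simp
  also have "\<dots> = \<Sum>{..<card S}"
    by (rule sum.cong) (auto intro: card_pick_le)
  finally show ?thesis .
qed

text \<open>
  As long as fewer than \<open>column_rank S\<close> unit moves have been made, the sum is not yet minimal, so
  some element exceeds a number outside the set by 1 and can be decreased to it.
\<close>

lemma set_leq_sum_diff_exists:
  assumes "finite S" and "r \<le> column_rank S"
  shows "\<exists>R. finite R \<and> set_leq R S \<and> \<Sum>R + r = \<Sum>S"
  using assms(2)
proof (induction r)
  case 0
  then show ?case
    using assms(1) set_leq_refl by auto
next
  case (Suc r)
  then obtain R where R: "finite R" "set_leq R S" "\<Sum>R + r = \<Sum>S"
    by auto
  have "card R = card S"
    using R(2) by (simp add: set_leq_def)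
  then have "column_rank R \<noteq> 0"
    using sum_eq_column_rank[OF R(1)] sum_eq_column_rank[OF assms(1)] R(3) Suc.prems by simp
  then obtain i k where ik: "i \<in> R" "k \<le> i" "k \<notin> R"
    unfolding column_rank_def by (metis (mono_tags, lifting) card.empty Collect_empty_eq sum.neutral)
  \<comment> \<open>Between an element and a smaller gap there is an element directly above a gap.\<close>
  have "\<exists>i. Suc i \<in> R \<and> i \<notin> R"
  proof (rule ccontr)
    assume "\<nexists>i. Suc i \<in> R \<and> i \<notin> R"
    then have down: "Suc j \<in> R \<Longrightarrow> j \<in> R" for j
      by blast
    have "k \<in> R"
      using ik(2,1) by (induction rule: inc_induct) (auto intro: down)
    with ik show False
      by simp
  qed
  then obtain i where i: "Suc i \<in> R" "i \<notin> R"
    by auto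
  define f where "f = id(Suc i := i)"
  have f: "strict_mono_on R f"
  proof (rule strict_mono_onI)
    fix x y assume "x \<in> R" "y \<in> R" "x < y"
    then show "f x < f y"
      using i by (cases "x = i") (auto simp: f_def less_Suc_eq)
  qed
  have "\<Sum>(f ` R) = (\<Sum>x\<in>R. f x)"
    by (simp add: sum.reindex strict_mono_on_imp_inj_on[OF f])
  also have "Suc \<dots> = \<Sum>R"
    using R(1) i(1) by (simp add: sum.remove[of R "Suc i"] f_def)
  finally have "\<Sum>(f ` R) + Suc r = \<Sum>S"
    using R(3) by simp
  moreover have "set_leq (f ` R) S"
    using set_leq_trans[OF set_leq_image[OF f] R(2)] by (auto simp: f_def)
  ultimately show ?case
    using R(1) by blast
qed

section \<open>Diagrams below a given diagram\<close>

lemma column_subset: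
  assumes "is_diagram n D"
  shows "column D j \<subseteq> {..<n}"
  using assms by (auto simp: is_diagram_def column_def)

lemma diagram_rank_eq_sum_column_rank:
  assumes "is_diagram n D"
  shows "diagram_rank D = (\<Sum>j<n. column_rank (column D j))"
proof -
  have fin: "finite (column D j)" for j
    using column_subset[OF assms] finite_subset by blast
  have "D = prod.swap ` (SIGMA j:{..<n}. column D j)"
    using assms by (force simp: is_diagram_def column_def)
  then have "diagram_rank D = (\<Sum>b\<in>prod.swap ` (SIGMA j:{..<n}. column D j). box_rank D b)"
    by (simp add: diagram_rank_def)
  also have "\<dots> = (\<Sum>(j, i)\<in>(SIGMA j:{..<n}. column D j). box_rank D (i, j))"
    by (subst sum.reindex) (simp_all add: case_prod_unfold prod.swap_def)
  also have "\<dots> = (\<Sum>j<n. column_rank (column D j))"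
    using fin by (simp add: sum.Sigma column_rank_def box_rank_def column_def)
  finally show ?thesis .
qed

text \<open>
  Distributes a total number of unit moves over the columns, column \<open>j\<close> having room for \<open>\<rho> j\<close>.
\<close>

lemma split_sum_bounded:
  fixes \<rho> :: "nat \<Rightarrow> nat"
  assumes "r \<le> (\<Sum>j<n. \<rho> j)"
  shows "\<exists>s. (\<forall>j<n. s j \<le> \<rho> j) \<and> (\<Sum>j<n. s j) = r"
  using assms
proof (induction n arbitrary: r)
  case (Suc n)
  have "r - min r (\<rho> n) \<le> (\<Sum>j<n. \<rho> j)"
    using Suc.prems by auto
  then obtain s where s: "\<forall>j<n. s j \<le> \<rho> j" "(\<Sum>j<n. s j) = r - min r (\<rho> n)"
    using Suc.IH by blast
  then show ?case
    by (intro exI[of _ "s(n := min r (\<rho> n))"]) (auto simp: less_Suc_eq)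
qed auto

definition row_sum :: "nat \<Rightarrow> diagram \<Rightarrow> nat" where
  "row_sum n C = (\<Sum>j<n. \<Sum>(column C j))"

lemma diagram_leq_row_sum_exists:
  assumes D: "is_diagram n D" and r: "r \<le> diagram_rank D"
  shows "\<exists>C. is_diagram n C \<and> diagram_leq n C D \<and> row_sum n C + r = row_sum n D"
proof -
  obtain s where s: "\<forall>j<n. s j \<le> column_rank (column D j)" "(\<Sum>j<n. s j) = r"
    using split_sum_bounded r diagram_rank_eq_sum_column_rank[OF D] by metis
  have fin: "finite (column D j)" for j
    using column_subset[OF D] finite_subset by blast
  have "\<forall>j. \<exists>R. j < n \<longrightarrow> finite R \<and> set_leq R (column D j) \<and> \<Sum>R + s j = \<Sum>(column D j)"
    using set_leq_sum_diff_exists[OF fin] s(1) by blast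
  then obtain R where R: "\<And>j. j < n \<Longrightarrow> finite (R j)"
      "\<And>j. j < n \<Longrightarrow> set_leq (R j) (column D j)"
      "\<And>j. j < n \<Longrightarrow> \<Sum>(R j) + s j = \<Sum>(column D j)"
    by metis
  define C where "C = {(i, j). j < n \<and> i \<in> R j}"
  have col: "column C j = R j" if "j < n" for j
    using that by (auto simp: C_def column_def)
  have "is_diagram n C"
    using set_leq_bounded[OF R(2) R(1) column_subset[OF D]]
    by (auto simp: C_def is_diagram_def)
  moreover have "diagram_leq n C D"
    using R(2) col by (simp add: diagram_leq_def)
  moreover have "row_sum n C + r = row_sum n D"
    using R(3) col by (simp add: row_sum_def flip: s(2) sum.distrib)
  ultimately show ?thesis
    by blast
qed

section \<open>The row grading\<close>

definition row_degree :: "(nat \<times> nat \<Rightarrow>\<^sub>0 nat) \<Rightarrow> nat" where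
  "row_degree m = (\<Sum>v\<in>Poly_Mapping.keys m. fst v * Poly_Mapping.lookup m v)"

text \<open>
  The monomials record both the degree and that only the indeterminates on or above the
  diagonal of \<open>Y_mat n\<close> occur. The degree separates the generators; the restriction on the
  indeterminates ensures that the identity matrix acts trivially, since \<open>borel_act\<close> replaces every other
  indeterminate by 0 or by an entry outside the matrix.
\<close>

definition Y_monomials :: "nat \<Rightarrow> nat \<Rightarrow> (nat \<times> nat \<Rightarrow>\<^sub>0 nat) set" where
  "Y_monomials n d = {m. Poly_Mapping.keys m \<subseteq> {(i, j). i \<le> j \<and> j < n} \<and> row_degree m = d}"

definition row_homogeneous :: "nat \<Rightarrow> nat \<Rightarrow> ypoly \<Rightarrow> bool" where
  "row_homogeneous n d f \<longleftrightarrow> Poly_Mapping.keys f \<subseteq> Y_monomials n d"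

lemma row_degree_add: "row_degree (m + m') = row_degree m + row_degree m'"
proof -
  let ?K = "Poly_Mapping.keys m \<union> Poly_Mapping.keys m'"
  have expand: "row_degree l = (\<Sum>v\<in>?K. fst v * Poly_Mapping.lookup l v)"
    if "Poly_Mapping.keys l \<subseteq> ?K" for l
    unfolding row_degree_def using that by (intro sum.mono_neutral_left) (auto simp: in_keys_iff)
  show ?thesis
    using keys_add[of m m'] by (simp add: expand lookup_add distrib_left sum.distrib)
qed

lemma row_homogeneous_0: "row_homogeneous n d 0"
  by (simp add: row_homogeneous_def)

lemma row_homogeneous_1: "row_homogeneous n 0 1"
  by (simp add: row_homogeneous_def Y_monomials_def row_degree_def)

lemma row_homogeneous_yvar:
  assumes "i \<le> j" and "j < n"
  shows "row_homogeneous n i (yvar (i, j))"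
  using assms by (simp add: row_homogeneous_def yvar_def Y_monomials_def row_degree_def)

lemma row_homogeneous_uminus: "row_homogeneous n d f \<Longrightarrow> row_homogeneous n d (- f)"
  by (simp add: row_homogeneous_def)

lemma row_homogeneous_sum:
  assumes "\<And>x. x \<in> A \<Longrightarrow> row_homogeneous n d (f x)"
  shows "row_homogeneous n d (\<Sum>x\<in>A. f x)"
  using keys_sum[of f A] assms by (fastforce simp: row_homogeneous_def)

lemma row_homogeneous_mult:
  assumes "row_homogeneous n d f" and "row_homogeneous n e g"
  shows "row_homogeneous n (d + e) (f * g)"
proof -
  have "a + b \<in> Y_monomials n (d + e)" if "a \<in> Y_monomials n d" "b \<in> Y_monomials n e" for a b
    using that keys_add[of a b] by (auto simp: Y_monomials_def row_degree_add)
  then show ?thesis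
    using assms keys_mult[of f g] unfolding row_homogeneous_def by fastforce
qed

lemma row_homogeneous_prod:
  assumes "\<And>x. x \<in> A \<Longrightarrow> row_homogeneous n (d x) (f x)"
  shows "row_homogeneous n (\<Sum>x\<in>A. d x) (\<Prod>x\<in>A. f x)"
  using assms
  by (induction A rule: infinite_finite_induct)
    (auto intro: row_homogeneous_mult row_homogeneous_1)

section \<open>Minors of the generic upper triangular matrix\<close>

lemma Y_minor_eq:
  assumes "R \<subseteq> {..<n}" and "S \<subseteq> {..<n}" and "card R = card S"
  shows "det (submatrix (Y_mat n) R S) =
    (\<Sum>p | p permutes {0..<card R}. signof p *
      (\<Prod>k = 0..<card R. if pick R k \<le> pick S (p k) then yvar (pick R k, pick S (p k)) else 0))"
proof -
  have R: "{i. i < n \<and> i \<in> R} = R" and S: "{j. j < n \<and> j \<in> S} = S"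
    using assms by auto
  have dim: "dim_row (Y_mat n) = n" "dim_col (Y_mat n) = n"
    by (simp_all add: Y_mat_def)
  have carrier: "submatrix (Y_mat n) R S \<in> carrier_mat (card R) (card R)"
    using assms(3) by (auto simp: dim_submatrix dim R S)
  have entry: "submatrix (Y_mat n) R S $$ (k, l) =
      (if pick R k \<le> pick S l then yvar (pick R k, pick S l) else 0)"
    if "k < card R" "l < card R" for k l
  proof -
    have "pick R k < n" "pick S l < n"
      using that assms pick_in_set_le[of k R] pick_in_set_le[of l S] by auto
    then show ?thesis
      using that assms(3) by (simp add: submatrix_index dim R S) (simp add: Y_mat_def)
  qed
  show ?thesis
    unfolding det_def'[OF carrier]
    by (intro sum.cong prod.cong arg_cong2[of _ _ _ _ "(*)"] refl entry)
      (auto simp: permutes_nat_less)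
qed

text \<open>Each term of the Leibniz expansion is 0 or has one factor from each row in \<open>R\<close>.\<close>

lemma row_homogeneous_Y_minor:
  assumes "R \<subseteq> {..<n}" and "S \<subseteq> {..<n}" and "card R = card S"
  shows "row_homogeneous n (\<Sum>R) (det (submatrix (Y_mat n) R S))"
  unfolding Y_minor_eq[OF assms]
proof (intro row_homogeneous_sum, clarify)
  fix p assume p: "p permutes {0..<card R}"
  let ?f = "\<lambda>k. if pick R k \<le> pick S (p k) then yvar (pick R k, pick S (p k)) else 0"
  have "row_homogeneous n (\<Sum>k = 0..<card R. pick R k) (\<Prod>k = 0..<card R. ?f k)"
  proof (rule row_homogeneous_prod)
    fix k assume "k \<in> {0..<card R}"
    then have "p k < card S"
      using p assms(3) by (auto simp: permutes_nat_less)
    then have "pick S (p k) < n"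
      using assms(2) pick_in_set_le by blast
    then show "row_homogeneous n (pick R k) (?f k)"
      by (auto intro: row_homogeneous_yvar row_homogeneous_0)
  qed
  moreover have "(\<Sum>k = 0..<card R. pick R k) = \<Sum>R"
    using sum_pick[of R "\<lambda>x. x"] finite_subset[OF assms(1)] by (simp add: atLeast0LessThan)
  ultimately show "row_homogeneous n (\<Sum>R) (signof p * (\<Prod>k = 0..<card R. ?f k))"
    by (auto simp: sign_def intro: row_homogeneous_uminus)
qed

lemma prod_single:
  "(\<Prod>x\<in>A. Poly_Mapping.single (m x) 1) = (Poly_Mapping.single (\<Sum>x\<in>A. m x) 1 :: ypoly)"
  by (induction A rule: infinite_finite_induct) (auto simp: mult_single)

text \<open>
  The monomial \<open>mon id\<close> on the diagonal of the minor has coefficient 1. The condition \<open>R \<le> S\<close>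
  says that its factors lie in the upper triangular part, and no other permutation
  yields it because the variables in a monomial determine the permutation.
\<close>

lemma Y_minor_nonzero:
  assumes "R \<subseteq> {..<n}" and "S \<subseteq> {..<n}" and "set_leq R S"
  shows "det (submatrix (Y_mat n) R S) \<noteq> 0"
proof -
  have card: "card R = card S" and le: "\<And>k. k < card R \<Longrightarrow> pick R k \<le> pick S k"
    using assms(3) by (auto simp: set_leq_def)
  have inj: "inj_on (pick R) {..<card R}" "inj_on (pick S) {..<card R}"
    using bij_betw_pick[of R] bij_betw_pick[of S] assms(1,2) card finite_subset[of _ "{..<n}"]
    by (auto simp: bij_betw_def)
  define mon where
    "mon p = (\<Sum>k = 0..<card R. Poly_Mapping.single (pick R k, pick S (p k)) (1 :: nat))" for p
  let ?P = "{p. p permutes {0..<card R}}"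
  let ?t = "\<lambda>p. \<Prod>k = 0..<card R.
    if pick R k \<le> pick S (p k) then yvar (pick R k, pick S (p k)) else 0"
  \<comment> \<open>Every variable of \<open>mon p\<close> must occur on the diagonal.\<close>
  have mon_id: "p = id" if p: "p permutes {0..<card R}" and eq: "mon p = mon id" for p
  proof
    fix k
    show "p k = id k"
    proof (cases "k < card R")
      case True
      then have pk: "p k < card R"
        using p by (simp add: permutes_nat_less)
      let ?v = "(pick R k, pick S (p k))"
      have "Poly_Mapping.lookup (mon p) ?v \<ge> Poly_Mapping.lookup (Poly_Mapping.single ?v 1) ?v"
        unfolding mon_def lookup_sum by (rule member_le_sum) (use True in auto)
      then have "Poly_Mapping.lookup (mon id) ?v \<noteq> 0"
        using eq by simp
      then obtain l where l: "l < card R" "(pick R l, pick S l) = ?v"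
        by (auto simp: mon_def lookup_sum lookup_single when_def split: if_splits)
      then have "l = k" "l = p k"
        using True pk inj by (auto simp: inj_on_def)
      then show ?thesis
        by simp
    next
      case False
      then show ?thesis
        using permutes_not_in[OF p, of k] by simp
    qed
  qed
  have "Poly_Mapping.lookup (signof p * ?t p) (mon id) = (if p = id then 1 else 0)"
    if p: "p permutes {0..<card R}" for p
  proof (cases "p = id")
    case True
    have "?t p = Poly_Mapping.single (mon id) 1"
      using True le by (simp add: yvar_def prod_single mon_def)
    then show ?thesis
      using True by simp
  next
    case False
    have "?t p = 0 \<or> ?t p = Poly_Mapping.single (mon p) 1"
    proof (cases "\<forall>k<card R. pick R k \<le> pick S (p k)")
      case True
      then show ?thesis
        by (simp add: yvar_def prod_single mon_def)
    next
      case False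
      then have "\<exists>k\<in>{0..<card R}. (if pick R k \<le> pick S (p k)
          then yvar (pick R k, pick S (p k)) else 0) = 0"
        by auto
      then have "?t p = 0"
        by (rule prod_zero[OF finite_atLeastLessThan])
      then show ?thesis
        by (rule disjI1)
    qed
    moreover have "mon p \<noteq> mon id"
      using mon_id[OF p] False by blast
    ultimately have "Poly_Mapping.lookup (?t p) (mon id) = 0"
      by (elim disjE) (simp_all only: lookup_zero lookup_single_not_eq not_False_eq_True)
    then show ?thesis
      using False by (cases "evenperm p") (simp_all only: sign_def if_True if_False of_int_1 of_int_minus
        mult_1 mult_minus_left lookup_uminus neg_equal_0_iff_equal)
  qed
  then have "Poly_Mapping.lookup (det (submatrix (Y_mat n) R S)) (mon id) =
      (\<Sum>p\<in>?P. if p = id then 1 else 0)"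
    unfolding Y_minor_eq[OF assms(1,2) card] lookup_sum by (intro sum.cong) auto
  also have "\<dots> = 1"
    by (simp add: finite_permutations permutes_id)
  finally show ?thesis
    by auto
qed

section \<open>The dimension of the flagged Weyl module\<close>

definition Weyl_generator :: "nat \<Rightarrow> diagram \<Rightarrow> diagram \<Rightarrow> ypoly" where
  "Weyl_generator n D C = (\<Prod>j<n. det (submatrix (Y_mat n) (column C j) (column D j)))"

lemma flagged_Weyl_module_eq:
  "flagged_Weyl_module n D =
    ypoly.span (Weyl_generator n D ` {C. is_diagram n C \<and> diagram_leq n C D})"
  unfolding flagged_Weyl_module_def Weyl_generator_def by (rule arg_cong[of _ _ ypoly.span]) auto

lemma finite_diagrams: "finite {C. is_diagram n C \<and> P C}"
  by (rule finite_subset[of _ "Pow ({..<n} \<times> {..<n})"]) (auto simp: is_diagram_def)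

lemma row_homogeneous_Weyl_generator:
  assumes "is_diagram n C" and "is_diagram n D" and "diagram_leq n C D"
  shows "row_homogeneous n (row_sum n C) (Weyl_generator n D C)"
  unfolding row_sum_def Weyl_generator_def
  using assms
  by (intro row_homogeneous_prod row_homogeneous_Y_minor)
    (auto simp: diagram_leq_def set_leq_def dest: column_subset)

text \<open>
  The lexicographic order on index pairs makes the monomials a linearly ordered monoid; this is
  what makes the polynomials an integral domain in the last step.
\<close>

lemma Weyl_generator_nonzero:
  assumes "is_diagram n C" and "is_diagram n D" and "diagram_leq n C D"
  shows "Weyl_generator n D C \<noteq> 0"
proof -
  have "det (submatrix (Y_mat n) (column C j) (column D j)) \<noteq> 0" if "j < n" for j
    using assms that by (intro Y_minor_nonzero column_subset) (auto simp: diagram_leq_def)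
  then show ?thesis
    by (simp add: Weyl_generator_def)
qed

lemma lookup_yscale: "Poly_Mapping.lookup (yscale c f) m = c * Poly_Mapping.lookup f m"
  unfolding yscale_def yconst_def
  by (simp flip: mult_map_scale_conv_mult add: map.rep_eq when_def)

text \<open>
  The sets of monomials of the \<open>f x\<close> are pairwise disjoint, so in a linear relation the
  coefficient of a monomial of \<open>f x\<close> involves only the scalar at \<open>f x\<close>.
\<close>

lemma independent_of_distinct_row_degrees:
  assumes "finite I" and "inj_on d I"
    and "\<And>x. x \<in> I \<Longrightarrow> row_homogeneous n (d x) (f x)" and "\<And>x. x \<in> I \<Longrightarrow> f x \<noteq> 0"
  shows "inj_on f I" and "ypoly.independent (f ` I)"
proof -
  have unique: "x = y" if "x \<in> I" "y \<in> I" "m \<in> Poly_Mapping.keys (f x)"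
    "m \<in> Poly_Mapping.keys (f y)" for x y m
  proof -
    have "d x = row_degree m" "d y = row_degree m"
      using assms(3)[OF that(1)] assms(3)[OF that(2)] that(3,4)
      by (auto simp: row_homogeneous_def Y_monomials_def)
    then show ?thesis
      using assms(2) that by (metis inj_onD)
  qed
  have nonempty: "\<exists>m. m \<in> Poly_Mapping.keys (f x)" if "x \<in> I" for x
    using assms(4)[OF that] by (metis ex_in_conv keys_eq_empty)
  show inj: "inj_on f I"
    by (rule inj_onI) (metis nonempty unique)
  show "ypoly.independent (f ` I)"
  proof (rule ypoly.independent_if_scalars_zero)
    fix c b assume sum: "(\<Sum>b\<in>f ` I. yscale (c b) b) = 0" and "b \<in> f ` I"
    then obtain x where x: "x \<in> I" "b = f x"
      by auto
    obtain m where m: "m \<in> Poly_Mapping.keys (f x)"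
      using nonempty x by auto
    have "0 = Poly_Mapping.lookup (\<Sum>b\<in>f ` I. yscale (c b) b) m"
      by (simp add: sum)
    also have "\<dots> = (\<Sum>y\<in>I. c (f y) * Poly_Mapping.lookup (f y) m)"
      by (simp add: sum.reindex[OF inj] lookup_sum lookup_yscale)
    also have "\<dots> = (\<Sum>y\<in>I. if y = x then c (f x) * Poly_Mapping.lookup (f x) m else 0)"
      using unique[OF x(1) _ m] by (intro sum.cong) (auto simp: in_keys_iff)
    also have "\<dots> = c b * Poly_Mapping.lookup (f x) m"
      using x assms(1) by simp
    finally show "c b = 0"
      using m by (simp add: in_keys_iff)
  qed (use assms(1) in simp)
qed

text \<open>
  The polynomial space has infinite dimension, where \<open>dim\<close> is 0 for a subspace without a finite
  basis; hence the finite spanning set.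
\<close>

lemma independent_card_le_dim:
  assumes "finite G" and "A \<subseteq> ypoly.span G" and "ypoly.independent A"
  shows "card A \<le> ypoly.dim G"
proof -
  obtain B where B: "B \<subseteq> G" "G \<subseteq> ypoly.span B" "card B = ypoly.dim G"
    by (rule ypoly.basis_exists[of G])
  have "ypoly.span G \<subseteq> ypoly.span B"
    by (rule ypoly.span_minimal[OF B(2) ypoly.subspace_span])
  then have "card A \<le> card B"
    using ypoly.independent_span_bound[OF finite_subset[OF B(1) assms(1)] assms(3)] assms(2)
    by simp
  with B(3) show ?thesis
    by simp
qed

text \<open>
  The bound comes from one generator for each of the degrees obtained by \<open>r \<le> rank(D)\<close> unit moves.
\<close>

lemma dim_flagged_Weyl_module:
  assumes D: "is_diagram n D"
  shows "diagram_rank D + 1 \<le> ypoly.dim (flagged_Weyl_module n D)"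
proof -
  obtain C where C: "\<And>r. r \<le> diagram_rank D \<Longrightarrow> is_diagram n (C r)"
      "\<And>r. r \<le> diagram_rank D \<Longrightarrow> diagram_leq n (C r) D"
      "\<And>r. r \<le> diagram_rank D \<Longrightarrow> row_sum n (C r) + r = row_sum n D"
    using diagram_leq_row_sum_exists[OF D] by metis
  let ?G = "Weyl_generator n D ` {C. is_diagram n C \<and> diagram_leq n C D}"
  let ?I = "{..diagram_rank D}"
  let ?f = "\<lambda>r. Weyl_generator n D (C r)"
  have inj: "inj_on (\<lambda>r. row_sum n (C r)) ?I"
    by (rule inj_onI) (metis C(3) add_left_cancel atMost_iff)
  have f: "inj_on ?f ?I" "ypoly.independent (?f ` ?I)"
    using independent_of_distinct_row_degrees[OF finite_atMost inj, of n ?f]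
      row_homogeneous_Weyl_generator[OF C(1) D C(2)] Weyl_generator_nonzero[OF C(1) D C(2)]
    by simp_all
  have "?f ` ?I \<subseteq> ypoly.span ?G"
    using C(1,2) by (auto intro!: ypoly.span_base)
  then have "card (?f ` ?I) \<le> ypoly.dim ?G"
    using f(2) by (rule independent_card_le_dim[OF finite_imageI[OF finite_diagrams]])
  then show ?thesis
    unfolding flagged_Weyl_module_eq ypoly.dim_span card_image[OF f(1)] by simp
qed

section \<open>The character at the identity\<close>

text \<open>
  Whichever basis the trace uses, every diagonal coefficient of the identity is 1.
\<close>

lemma trace_on_identity:
  assumes "\<And>f. f \<in> ypoly.span G \<Longrightarrow> T f = f"
  shows "trace_on (ypoly.span G) T = of_nat (ypoly.dim G)"
proof -
  define B where "B = (SOME B. ypoly.independent B \<and> ypoly.span B = ypoly.span G)"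
  have "\<exists>B. ypoly.independent B \<and> ypoly.span B = ypoly.span G"
    by (metis ypoly.maximal_independent_subset ypoly.span_subspace ypoly.subspace_span)
  then have B: "ypoly.independent B" "ypoly.span B = ypoly.span G"
    unfolding B_def by (metis (mono_tags, lifting) someI_ex)+
  have "T b = b" if "b \<in> B" for b
    using assms ypoly.span_base[OF that] B(2) by simp
  then have "trace_on (ypoly.span G) T = (\<Sum>b\<in>B. 1)"
    unfolding trace_on_def B_def[symmetric] Let_def
    by (intro sum.cong) (auto simp: ypoly.representation_basis[OF B(1)])
  then show ?thesis
    using ypoly.dim_eq_card[OF B(2,1)] by simp
qed

lemma sum_keys_single:
  "(\<Sum>k\<in>Poly_Mapping.keys p. Poly_Mapping.single k (Poly_Mapping.lookup p k)) = p"
  by (rule poly_mapping_eqI) (simp add: lookup_sum lookup_single when_def in_keys_iff)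

lemma yvar_power: "yvar v ^ k = Poly_Mapping.single (Poly_Mapping.single v k) 1"
  by (induction k) (simp_all add: yvar_def mult_single flip: single_add)

lemma single_eq_prod_yvar:
  "(\<Prod>v\<in>Poly_Mapping.keys m. yvar v ^ Poly_Mapping.lookup m v) = Poly_Mapping.single m 1"
  by (simp add: yvar_power prod_single sum_keys_single)

lemma ysubst_yvar:
  assumes "\<And>m v. m \<in> Poly_Mapping.keys f \<Longrightarrow> v \<in> Poly_Mapping.keys m \<Longrightarrow> \<sigma> v = yvar v"
  shows "ysubst \<sigma> f = f"
proof -
  have "ysubst \<sigma> f = (\<Sum>m\<in>Poly_Mapping.keys f.
      yconst (Poly_Mapping.lookup f m) * (\<Prod>v\<in>Poly_Mapping.keys m. yvar v ^ Poly_Mapping.lookup m v))"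
    unfolding ysubst_def
    by (intro sum.cong arg_cong2[of _ _ _ _ "(*)"] prod.cong arg_cong2[of _ _ _ _ "(^)"])
      (auto simp: assms)
  also have "\<dots> = (\<Sum>m\<in>Poly_Mapping.keys f. Poly_Mapping.single m (Poly_Mapping.lookup f m))"
    by (simp add: single_eq_prod_yvar yconst_def mult_single)
  also have "\<dots> = f"
    by (simp add: sum_keys_single)
  finally show ?thesis .
qed

lemma mat_inverse_one: "mat_inverse (1\<^sub>m n :: complex mat) = Some (1\<^sub>m n)"
proof (cases "mat_inverse (1\<^sub>m n :: complex mat)")
  case None
  have "(1\<^sub>m n :: complex mat) \<in> Units (ring_mat TYPE(complex) n ())"
    by (auto simp: Units_def ring_mat_def)
  then show ?thesis
    using mat_inverse(1)[OF one_carrier_mat None, of "()"] by blast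
next
  case (Some B)
  then show ?thesis
    using mat_inverse(2)[OF one_carrier_mat Some] left_mult_one_mat[of B n n] by simp
qed

lemma borel_act_one:
  assumes "\<And>m. m \<in> Poly_Mapping.keys f \<Longrightarrow> Poly_Mapping.keys m \<subseteq> {(i, j). i \<le> j \<and> j < n}"
  shows "borel_act n (1\<^sub>m n) f = f"
proof -
  have "map_mat yconst (1\<^sub>m n) = (1\<^sub>m n :: ypoly mat)"
    by (rule eq_matI) (auto simp: yconst_def)
  then have "borel_act n (1\<^sub>m n) f = ysubst (\<lambda>v. (1\<^sub>m n * Y_mat n) $$ v) f"
    by (simp add: borel_act_def mat_inverse_one)
  also have "1\<^sub>m n * Y_mat n = Y_mat n"
    by (rule left_mult_one_mat[of _ n n]) (simp add: Y_mat_def)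
  also have "ysubst (\<lambda>v. Y_mat n $$ v) f = f"
    by (rule ysubst_yvar) (use assms in \<open>fastforce simp: Y_mat_def\<close>)
  finally show ?thesis .
qed

text \<open>
  Elements of the module are in general not homogeneous, but the indeterminates that occur in
  the generators also bound those in their linear combinations.
\<close>

lemma keys_flagged_Weyl_module:
  assumes D: "is_diagram n D" and f: "f \<in> flagged_Weyl_module n D"
    and "m \<in> Poly_Mapping.keys f"
  shows "Poly_Mapping.keys m \<subseteq> {(i, j). i \<le> j \<and> j < n}"
proof -
  have "\<forall>m\<in>Poly_Mapping.keys f. Poly_Mapping.keys m \<subseteq> {(i, j). i \<le> j \<and> j < n}"
    using f unfolding flagged_Weyl_module_eq
  proof (induction rule: ypoly.span_induct_alt)
    case base
    then show ?case
      by simp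
  next
    case (step c g h)
    then obtain d where "row_homogeneous n d g"
      using row_homogeneous_Weyl_generator D by blast
    moreover have "Poly_Mapping.keys (yscale c g + h) \<subseteq> Poly_Mapping.keys g \<union> Poly_Mapping.keys h"
      by (auto simp: in_keys_iff lookup_add lookup_yscale)
    ultimately show ?case
      using step.IH by (auto simp: row_homogeneous_def Y_monomials_def)
  qed
  then show ?thesis
    using assms(3) by blast
qed

lemma Weyl_dual_char_one:
  assumes "is_diagram n D"
  shows "Weyl_dual_char n D (\<lambda>_. 1) = of_nat (ypoly.dim (flagged_Weyl_module n D))"
proof -
  have "borel_act n (1\<^sub>m n) f = f" if "f \<in> flagged_Weyl_module n D" for f
    using keys_flagged_Weyl_module[OF assms that] by (rule borel_act_one)
  then show ?thesis
    unfolding Weyl_dual_char_def dual_char_def mod_char_def flagged_Weyl_module_eq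
    by (simp add: trace_on_identity)
qed

theorem theorem1p2:
  fixes n :: nat and D :: diagram
  assumes "n > 0" and "is_diagram n D"
  shows "Weyl_dual_char n D (\<lambda>_. 1) \<ge> of_nat (diagram_rank D) + 1"
proof -
  have "diagram_rank D + 1 \<le> ypoly.dim (flagged_Weyl_module n D)"
    using assms(2) by (rule dim_flagged_Weyl_module)
  then have "(of_nat (diagram_rank D) + 1 :: complex) \<le>
      of_nat (ypoly.dim (flagged_Weyl_module n D))"
    by (simp add: less_eq_complex_def)
  then show ?thesis
    by (simp only: Weyl_dual_char_one[OF assms(2)])
qed

end
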